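(* Let $k\ge 2$, let $\Sigma$ be an alphabet of $k$ symbols with symbol codes $0,\dots,k-1$, let $\beta=k+1$, and let $\ulcorner\cdot\urcorner$ be the block-partition encoding. For $m\ge1$ let $L(m)=\max\{\operatorname{digits}(\ulcorner s\urcorner): s\in\Sigma^m\}$, where $\operatorname{digits}(n)$ is the number of decimal digits of $n$. Then $L(m)=\Theta(m)$ as $m\to\infty$ (for fixed $k$).
   Context: $F_n$ is the Fibonacci sequence ($F_0=0$, $F_1=1$, $F_{n+2}=F_{n+1}+F_n$). The block-partition encoding is $\ulcorner\varepsilon\urcorner=0$ and, for a nonempty string $s=s_1\cdots s_m$ with symbol codes $c_1,\dots,c_m\in\{0,\dots,k-1\}$, $\ulcorner s\urcorner=\sum_{i=0}^{m-1}F_{2+i\beta+c_{i+1}}$. *)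

theory Defs
  imports
    "HOL-Number_Theory.Fib"
    "HOL-Library.Landau_Symbols"
begin

text \<open>Symbols of a string are indexed from 0, so \<^term>\<open>s ! i\<close> is the symbol with 1-based position
  \<^term>\<open>i + 1\<close>. For the empty string the sum is empty, which gives the encoding 0.\<close>

definition block_encode :: "nat \<Rightarrow> ('a \<Rightarrow> nat) \<Rightarrow> 'a list \<Rightarrow> nat" where
  "block_encode \<beta> code s = (\<Sum>i<length s. fib (2 + i * \<beta> + code (s ! i)))"

lemma block_encode_Nil: "block_encode \<beta> code [] = 0"
  by (simp add: block_encode_def)

text \<open>Convention: 0 has one decimal digit.\<close>

fun digits :: "nat \<Rightarrow> nat" where
  "digits n = (if n < 10 then 1 else Suc (digits (n div 10)))"

declare digits.simps [simp del]

definition strings_of_length :: "'a set \<Rightarrow> nat \<Rightarrow> 'a list set" where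
  "strings_of_length \<Sigma> m = {s. set s \<subseteq> \<Sigma> \<and> length s = m}"

text \<open>The maximum is over a finite nonempty set whenever \<^term>\<open>\<Sigma>\<close> is finite and nonempty.\<close>

definition max_digits :: "'a set \<Rightarrow> ('a \<Rightarrow> nat) \<Rightarrow> nat \<Rightarrow> nat \<Rightarrow> nat" where
  "max_digits \<Sigma> code \<beta> m =
     Max ((\<lambda>s. digits (block_encode \<beta> code s)) ` strings_of_length \<Sigma> m)"

end

theory Submission
  imports Defs
begin

text \<open>An encoding of a string of length \<open>m\<close> lies between \<open>2 ^ (m - 1)\<close> and
  \<open>2 ^ (m * (\<beta> + 1))\<close>: it is at least its last summand, and it has \<open>m\<close> summands, each at
  most \<open>fib (m * \<beta>)\<close>. The crude bounds \<open>2 ^ j \<le> fib (2 + 2 * j)\<close> and \<open>fib n \<le> 2 ^ n\<close> suffice,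
  since constant factors in the exponent do not matter. The bounds hold for every
  string, so it does not matter where the maximum is attained.\<close>

lemma less_power_digits: "n < 10 ^ digits n"
proof (induction n rule: less_induct)
  case (less n)
  show ?case
  proof (cases "n < 10")
    case True
    then show ?thesis by (simp add: digits.simps)
  next
    case False
    then have "n div 10 < 10 ^ digits (n div 10)"
      by (intro less) simp
    then have "n < 10 * 10 ^ digits (n div 10)"
      by linarith
    then show ?thesis
      using False by (subst digits.simps) simp
  qed
qed

text \<open>The hypothesis \<open>0 < d\<close> excludes \<open>n = 0\<close>, \<open>d = 0\<close>,
  where \<open>n < 10 ^ d\<close> holds although \<open>digits 0 = 1\<close>.\<close>

lemma digits_le:
  assumes "n < 10 ^ d" "0 < d"
  shows "digits n \<le> d"
  using assms
proof (induction d arbitrary: n)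
  case (Suc d)
  show ?case
  proof (cases "n < 10")
    case True
    then show ?thesis by (simp add: digits.simps)
  next
    case False
    then have "0 < d"
      using Suc.prems by (cases d) auto
    moreover have "n div 10 < 10 ^ d"
      using Suc.prems by (simp add: less_mult_imp_div_less mult.commute)
    ultimately have "digits (n div 10) \<le> d"
      using Suc.IH by blast
    then show ?thesis
      using False by (subst digits.simps) simp
  qed
qed simp

lemma fib_le_power2: "fib n \<le> 2 ^ n"
proof (induction n rule: fib.induct)
  case (3 n)
  have "fib (Suc (Suc n)) \<le> 2 ^ Suc n + 2 ^ n"
    using 3 by simp
  then show ?case by simp
qed auto

text \<open>By monotonicity, moving two indices along at least doubles a Fibonacci number. The
  stride 2 is at most the block length when \<open>2 \<le> \<beta>\<close>.\<close>

lemma power2_le_fib: "2 ^ j \<le> fib (2 + 2 * j)"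
proof (induction j)
  case (Suc j)
  have "fib (2 + 2 * j) \<le> fib (3 + 2 * j)"
    by (intro fib_mono) simp
  moreover have "fib (2 + 2 * Suc j) = fib (3 + 2 * j) + fib (2 + 2 * j)"
    by (simp add: numeral_eq_Suc)
  ultimately show ?case
    using Suc by simp
qed simp

lemma block_encode_upper:
  assumes "\<And>a. a \<in> set s \<Longrightarrow> code a + 2 \<le> \<beta>"
  shows "block_encode \<beta> code s \<le> 2 ^ (length s * (\<beta> + 1))"
proof -
  let ?m = "length s"
  have "fib (2 + i * \<beta> + code (s ! i)) \<le> 2 ^ (?m * \<beta>)" if "i < ?m" for i
  proof -
    \<comment> \<open>The offset 2 and the symbol code together fit into one further block of length
      \<open>\<beta>\<close>.\<close>
    have "2 + i * \<beta> + code (s ! i) \<le> Suc i * \<beta>"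
      using assms[of "s ! i"] that by simp
    also have "\<dots> \<le> ?m * \<beta>"
      using that by (intro mult_right_mono) auto
    finally show ?thesis
      using fib_mono fib_le_power2 order_trans by blast
  qed
  then have "block_encode \<beta> code s \<le> (\<Sum>i<?m. 2 ^ (?m * \<beta>))"
    unfolding block_encode_def by (intro sum_mono) simp
  also have "\<dots> = ?m * 2 ^ (?m * \<beta>)"
    by simp
  \<comment> \<open>The number of summands is absorbed by \<open>m < 2 ^ m\<close>; this is the
    \<open>+ 1\<close> in the exponent.\<close>
  also have "\<dots> \<le> 2 ^ ?m * 2 ^ (?m * \<beta>)"
    by (intro mult_right_mono) (auto intro: less_imp_le)
  finally show ?thesis
    by (simp add: power_add algebra_simps)
qed

lemma block_encode_lower:
  assumes "2 \<le> \<beta>" "s \<noteq> []"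
  shows "2 ^ (length s - 1) \<le> block_encode \<beta> code s"
proof -
  let ?j = "length s - 1"
  have "2 ^ ?j \<le> fib (2 + 2 * ?j)"
    by (rule power2_le_fib)
  also have "\<dots> \<le> fib (2 + ?j * \<beta> + code (s ! ?j))"
    using assms(1) by (intro fib_mono) (simp add: mult.commute trans_le_add1)
  also have "\<dots> \<le> block_encode \<beta> code s"
    unfolding block_encode_def using assms(2)
    by (intro member_le_sum[where f = "\<lambda>i. fib (2 + i * \<beta> + code (s ! i))"]) auto
  finally show ?thesis .
qed

lemma digits_block_encode_upper:
  assumes "\<And>a. a \<in> set s \<Longrightarrow> code a + 2 \<le> \<beta>" "s \<noteq> []"
  shows "digits (block_encode \<beta> code s) \<le> length s * (\<beta> + 1)"
proof (rule digits_le)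
  have "block_encode \<beta> code s \<le> 2 ^ (length s * (\<beta> + 1))"
    using assms(1) by (rule block_encode_upper)
  \<comment> \<open>Strictness needs a positive exponent, hence a nonempty string.\<close>
  also have "\<dots> < 10 ^ (length s * (\<beta> + 1))"
    using assms(2) by (intro power_strict_mono) auto
  finally show "block_encode \<beta> code s < 10 ^ (length s * (\<beta> + 1))" .
qed (use assms(2) in simp)

lemma digits_block_encode_lower:
  assumes "2 \<le> \<beta>" "s \<noteq> []"
  shows "length s \<le> 4 * digits (block_encode \<beta> code s)"
proof -
  let ?n = "block_encode \<beta> code s"
  have "(2::nat) ^ (length s - 1) \<le> ?n"
    using assms by (rule block_encode_lower)
  also have "\<dots> < 10 ^ digits ?n"
    by (rule less_power_digits)
  \<comment> \<open>Rounding 10 up to \<open>16 = 2 ^ 4\<close> allows exponents to base 2 to be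
    compared; the factor 4 comes from here.\<close>
  also have "\<dots> \<le> 16 ^ digits ?n"
    by (intro power_mono) auto
  also have "\<dots> = 2 ^ (4 * digits ?n)"
    by (simp add: power_mult)
  finally have "length s - 1 < 4 * digits ?n"
    by simp
  \<comment> \<open>The strict inequality makes up for the 1 subtracted from the length.\<close>
  then show ?thesis by linarith
qed

theorem theorem5p1:
  fixes k \<beta> :: nat and \<Sigma> :: "'a set" and code :: "'a \<Rightarrow> nat"
  assumes "k \<ge> 2"
    and "bij_betw code \<Sigma> {0..<k}"
    and "\<beta> = k + 1"
  shows "(\<lambda>m. real (max_digits \<Sigma> code \<beta> m)) \<in> \<Theta>(\<lambda>m. real m)"
proof -
  have "finite \<Sigma>"
    using assms(2) bij_betw_finite by blast
  \<comment> \<open>Codes are at most \<open>k - 1\<close>, and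
    \<open>\<beta> = k + 1\<close>.\<close>
  have code: "code a + 2 \<le> \<beta>" if "a \<in> \<Sigma>" for a
    using bij_betwE[OF assms(2)] that assms(3) by fastforce
  \<comment> \<open>At \<open>m = 0\<close> the upper bound fails: the empty string has encoding 0,
    which counts as one digit.\<close>
  have bounds: "m \<le> 4 * max_digits \<Sigma> code \<beta> m \<and> max_digits \<Sigma> code \<beta> m \<le> m * (\<beta> + 1)"
    if "0 < m" for m
  proof -
    let ?D = "(\<lambda>s. digits (block_encode \<beta> code s)) ` strings_of_length \<Sigma> m"
    have "finite ?D"
      unfolding strings_of_length_def using \<open>finite \<Sigma>\<close> by (intro finite_imageI finite_lists_length_eq)
    moreover have "?D \<noteq> {}"
    proof -
      \<comment> \<open>The alphabet is nonempty because \<open>k \<ge> 2\<close>.\<close>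
      obtain a where "a \<in> \<Sigma>"
        using assms(1,2) by (fastforce simp: bij_betw_def)
      then have "replicate m a \<in> strings_of_length \<Sigma> m"
        by (auto simp: strings_of_length_def)
      then show ?thesis by blast
    qed
    ultimately have "max_digits \<Sigma> code \<beta> m \<in> ?D"
      unfolding max_digits_def by (rule Max_in)
    then obtain s where s: "set s \<subseteq> \<Sigma>" "length s = m"
      and max: "max_digits \<Sigma> code \<beta> m = digits (block_encode \<beta> code s)"
      by (auto simp: strings_of_length_def)
    have "s \<noteq> []"
      using s(2) that by auto
    have "digits (block_encode \<beta> code s) \<le> length s * (\<beta> + 1)"
      using code s(1) \<open>s \<noteq> []\<close> by (intro digits_block_encode_upper) auto
    moreover have "length s \<le> 4 * digits (block_encode \<beta> code s)"
      using assms(1,3) \<open>s \<noteq> []\<close> by (intro digits_block_encode_lower) auto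
    ultimately show ?thesis
      using s(2) max by metis
  qed
  show ?thesis
  proof (rule bigthetaI')
    show "\<forall>\<^sub>F m in at_top. 1 / 4 * norm (real m) \<le> norm (real (max_digits \<Sigma> code \<beta> m)) \<and>
        norm (real (max_digits \<Sigma> code \<beta> m)) \<le> real (\<beta> + 1) * norm (real m)"
      using eventually_gt_at_top[of 0]
    proof eventually_elim
      case (elim m)
      have "real m \<le> real (4 * max_digits \<Sigma> code \<beta> m)"
        and "real (max_digits \<Sigma> code \<beta> m) \<le> real (m * (\<beta> + 1))"
        using bounds[OF elim] by (simp_all only: of_nat_le_iff)
      then show ?case by (simp add: algebra_simps)
    qed
  qed auto
qed

end
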